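(* Let $(\Omega,\mathcal{F},P)$ be a probability space carrying a binary random variable $X$, with values in $\{0,1\}$, finite discrete random variables $Y_0,Y_1$ (the potential outcomes), and the observable random variable $Y(\omega)=I_0(\omega)Y_0(\omega)+I_1(\omega)Y_1(\omega)$, where $I_x$ is the indicator of the event $\{X=x\}$. Let $(\tilde\Omega,\tilde{\mathcal F},\tilde P)$, $\tilde X$, $\tilde Y$ be the probability space and random variables produced by an experimental randomization of $X$. Then for each $x\in\{0,1\}$, $$P_{Y_x}=P_{\tilde Y\mid \tilde X=x},$$ that is, for every real $y$, $P(Y_x=y)=\tilde P(\tilde Y=y\mid \tilde X=x)$.
   Context: An experimental randomization of $X$ is the following construction. Let $(\Omega_R,\mathcal{F}_R,P_R)$ be an arbitrary new probability space carrying a $\{0,1\}$-valued random variable $X_R$ such that $P_{X_R}(x)=P_R(X_R=x)\in(0,1)$ for all $x\in\{0,1\}$. Define the product probability space $$(\tilde\Omega,\tilde{\mathcal F},\tilde P)=(\Omega\times\Omega_R,\ \mathcal F\times\mathcal F_R,\ P\times P_R)$$ and, for $\tilde\omega=(\omega,\omega_R)\in\tilde\Omega$, $$\tilde X(\tilde\omega)=X_R(\omega_R),\qquad \tilde Y(\tilde\omega)=\tilde I_0(\omega_R)Y_0(\omega)+\tilde I_1(\omega_R)Y_1(\omega),$$ where $\tilde I_x(\omega_R)$ is the indicator of the event $\{X_R=x\}$. For a finite discrete random variable $W$, $P_W$ denotes its probability law, $P_W(w)=P(W=w)$; conditional laws are defined by $P_{\tilde Y\mid\tilde X=x}(y)=\tilde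 P(\{\tilde Y=y\}\cap\{\tilde X=x\})/\tilde P(\tilde X=x)$. *)

theory Defs
  imports "HOL-Probability.Probability"
begin

definition binary_rv :: "'a measure \<Rightarrow> ('a \<Rightarrow> nat) \<Rightarrow> bool" where
  "binary_rv M X \<longleftrightarrow> X \<in> measurable M (count_space {0, 1})"

(* Library simple functions are the measurable functions with finite range on the space of M. *)
definition finite_discrete_rv :: "'a measure \<Rightarrow> ('a \<Rightarrow> real) \<Rightarrow> bool" where
  "finite_discrete_rv M W \<longleftrightarrow> simple_function M W"

definition event_ind :: "'a measure \<Rightarrow> ('a \<Rightarrow> nat) \<Rightarrow> nat \<Rightarrow> 'a \<Rightarrow> real" where
  "event_ind M X x = indicator {\<omega> \<in> space M. X \<omega> = x}"

definition prob_law :: "'a measure \<Rightarrow> ('a \<Rightarrow> 'b) \<Rightarrow> 'b \<Rightarrow> real" where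
  "prob_law M W w = \<P>(\<omega> in M. W \<omega> = w)"

definition cond_law :: "'a measure \<Rightarrow> ('a \<Rightarrow> 'b) \<Rightarrow> ('a \<Rightarrow> 'c) \<Rightarrow> 'c \<Rightarrow> 'b \<Rightarrow> real" where
  "cond_law M V W w v = \<P>(\<omega> in M. V \<omega> = v \<bar> W \<omega> = w)"

(* Potential outcomes are a family Y indexed by nat, of which only Y 0 and Y 1 matter. *)
definition observed_outcome ::
    "'a measure \<Rightarrow> ('a \<Rightarrow> nat) \<Rightarrow> (nat \<Rightarrow> 'a \<Rightarrow> real) \<Rightarrow> 'a \<Rightarrow> real" where
  "observed_outcome M X Y \<omega> = event_ind M X 0 \<omega> * Y 0 \<omega> + event_ind M X 1 \<omega> * Y 1 \<omega>"

definition randomizer :: "'r measure \<Rightarrow> ('r \<Rightarrow> nat) \<Rightarrow> bool" where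
  "randomizer R XR \<longleftrightarrow> prob_space R \<and> binary_rv R XR \<and>
     (\<forall>x\<in>{0, 1}. prob_law R XR x \<in> {0<..<1})"

definition rand_space :: "'a measure \<Rightarrow> 'r measure \<Rightarrow> ('a \<times> 'r) measure" where
  "rand_space M R = M \<Otimes>\<^sub>M R"

definition rand_treatment :: "('r \<Rightarrow> nat) \<Rightarrow> 'a \<times> 'r \<Rightarrow> nat" where
  "rand_treatment XR = (\<lambda>(\<omega>, \<omega>R). XR \<omega>R)"

definition rand_outcome ::
    "'r measure \<Rightarrow> ('r \<Rightarrow> nat) \<Rightarrow> (nat \<Rightarrow> 'a \<Rightarrow> real) \<Rightarrow> 'a \<times> 'r \<Rightarrow> real" where
  "rand_outcome R XR Y =
     (\<lambda>(\<omega>, \<omega>R). event_ind R XR 0 \<omega>R * Y 0 \<omega> + event_ind R XR 1 \<omega>R * Y 1 \<omega>)"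

end

(* On the event that the randomized treatment equals x, the randomized outcome is Y x; the two
   events in the conditional probability are therefore rectangles with the same side in R, whose
   positive probability cancels. *)
theory Submission
  imports Defs
begin

theorem theorem1:
  fixes M :: "'a measure" and X :: "'a \<Rightarrow> nat"
    and Y :: "nat \<Rightarrow> 'a \<Rightarrow> real" and Yobs :: "'a \<Rightarrow> real"
    and R :: "'r measure" and XR :: "'r \<Rightarrow> nat"
  assumes "prob_space M"
    and "binary_rv M X"
    and "\<forall>x\<in>{0, 1}. finite_discrete_rv M (Y x)"
    and "\<forall>\<omega>\<in>space M. Yobs \<omega> = observed_outcome M X Y \<omega>"
    and "randomizer R XR"
  shows "\<forall>x\<in>{0, 1}. prob_law M (Y x) =
           cond_law (rand_space M R) (rand_outcome R XR Y) (rand_treatment XR) x"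
proof (intro ballI ext)
  fix x :: nat and y :: real
  assume x: "x \<in> {0, 1}"
  interpret M: prob_space M by fact
  interpret R: prob_space R using assms(5) by (simp add: randomizer_def)
  define A where "A = {\<omega> \<in> space M. Y x \<omega> = y}"
  define B where "B = {\<omega> \<in> space R. XR \<omega> = x}"
  have "simple_function M (Y x)"
    using assms(3) x by (auto simp: finite_discrete_rv_def)
  then have A: "A \<in> sets M"
    unfolding A_def using borel_measurable_simple_function[of M "Y x"] by measurable
  have "XR \<in> measurable R (count_space {0, 1})"
    using assms(5) by (simp add: randomizer_def binary_rv_def)
  \<comment> \<open>\<open>B\<close> is the preimage of \<open>{x}\<close>; the restriction of x to
    0 and 1 makes \<open>{x}\<close> a set of \<open>count_space {0, 1}\<close>.\<close>
  then have B: "B \<in> sets R"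
    using measurable_sets[of XR R "count_space {0, 1}" "{x}"] x
    by (simp add: B_def vimage_def Int_def conj_commute)
  \<comment> \<open>The lower bound on the law of \<open>XR\<close>. A quotient by zero would be 0
    by convention, so cancelling this factor needs strict positivity.\<close>
  have B_pos: "measure R B > 0"
    using assms(5) x by (auto simp: randomizer_def prob_law_def B_def)
  \<comment> \<open>For either value of x, on \<open>B\<close> the indicator for x is 1 and the
    other is 0, which leaves only the summand \<open>Y x\<close>.\<close>
  have joint: "{\<omega> \<in> space (rand_space M R). rand_outcome R XR Y \<omega> = y \<and> rand_treatment XR \<omega> = x} = A \<times> B"
    using x by (auto simp: A_def B_def rand_space_def space_pair_measure rand_outcome_def
        rand_treatment_def event_ind_def)
  have marginal: "{\<omega> \<in> space (rand_space M R). rand_treatment XR \<omega> = x} = space M \<times> B"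
    by (auto simp: B_def rand_space_def space_pair_measure rand_treatment_def)
  \<comment> \<open>Kept general in \<open>C\<close> to serve both the numerator
    (\<open>C = A\<close>) and the denominator (\<open>C = space M\<close>).\<close>
  have rectangle: "measure (rand_space M R) (C \<times> B) = measure M C * measure R B"
    if "C \<in> sets M" for C
    using that B
    by (simp add: rand_space_def measure_def R.emeasure_pair_measure_Times enn2real_mult)
  \<comment> \<open>The conditional probability is
    \<open>measure M A * measure R B / (1 * measure R B)\<close>, the 1 being the total mass of
    \<open>M\<close>.\<close>
  show "prob_law M (Y x) y =
      cond_law (rand_space M R) (rand_outcome R XR Y) (rand_treatment XR) x y"
    using A B_pos
    by (simp add: prob_law_def cond_law_def cond_prob_def joint marginal rectangle
        M.prob_space flip: A_def)
qed

end
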